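(* Let $T_1,T_2,T_3$ be three positive integers, let $T$ and $h_3$ be as defined in the context, and choose the multiplicative constant in $h_3$ so that $h_3$ is positive in a right neighborhood of $0$. (i) $h_3$ is nonnegative in $(0,T)$. (ii) Suppose that $\gcd(T_1,T_2,T_3)=1$. Then $h_3$ vanishes on at least one of the intervals $(j-1,j)$, $j=1,\ldots,T$, if and only if $1<\gcd(T_i,T_j)<\min(T_i,T_j)$ for all $i\neq j$ in $\{1,2,3\}$.
   Context: For a positive real number $S$, $X_S$ denotes the vector space of locally square summable, $S$-periodic functions (complex-valued, on $\mathbb R$) with zero mean value over a period. Given positive integers $T_1,T_2,T_3$, put $X:=X_{T_1}+X_{T_2}+X_{T_3}$ and $$T:=T_1+T_2+T_3-\gcd(T_1,T_2)-\gcd(T_2,T_3)-\gcd(T_3,T_1)+\gcd(T_1,T_2,T_3).$$ It is known from earlier work that the orthogonal complement in $L^2(0,T)$ of the set of restrictions to $(0,T)$ of the functions of $X$ is one-dimensional and is spanned by a real-valued function; $h_3$ denotes such a nonzero real-valued function, determined up to a nonzero real multiplicative constant (so $\int_0^T h_3(t)f(t)\,dt=0$ for all $f\in X$). It is also known that, with $g:=\gcd(T_1,T_2,T_3)$, $h_3$ is (almost everywhere equal to a function which is) constant on each interval $((j-1)g,jg)$, $j=1,\ldots,T/g$, and that this constant is nonzero on the first and the last of these intervals. *)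

theory Defs
  imports "HOL-Analysis.Analysis"
begin

text \<open>
  Elements of \<open>L\<^sup>2\<close> are represented by functions rather than by classes modulo null sets, so
  equalities and inequalities between them are stated almost everywhere. Only the values on \<open>A\<close>
  matter for membership in \<open>L2 A\<close>.
\<close>

definition L2 :: "real set \<Rightarrow> (real \<Rightarrow> complex) set" where
  "L2 A = {f. f \<in> borel_measurable (lebesgue_on A) \<and>
              integrable (lebesgue_on A) (\<lambda>t. (cmod (f t))\<^sup>2)}"

text \<open>
  Periodicity is required at every point: each almost everywhere periodic function has such a
  representative.
\<close>

definition X_space :: "real \<Rightarrow> (real \<Rightarrow> complex) set" where
  "X_space S = {f. (\<forall>a b. f \<in> L2 {a..b}) \<and>
                   (\<forall>t. f (t + S) = f t) \<and>
                   integral\<^sup>L (lebesgue_on {0..S}) f = 0}"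

definition X_sum :: "nat \<Rightarrow> nat \<Rightarrow> nat \<Rightarrow> (real \<Rightarrow> complex) set" where
  "X_sum T1 T2 T3 = {\<lambda>t. f1 t + f2 t + f3 t | f1 f2 f3.
     f1 \<in> X_space (real T1) \<and> f2 \<in> X_space (real T2) \<and> f3 \<in> X_space (real T3)}"

text \<open>
  For positive arguments no subtraction is truncated, since
  \<open>gcd T1 T2 \<le> T1\<close>, \<open>gcd T2 T3 \<le> T2\<close> and \<open>gcd T3 T1 \<le> T3\<close>.
\<close>

definition crit_time :: "nat \<Rightarrow> nat \<Rightarrow> nat \<Rightarrow> nat" where
  "crit_time T1 T2 T3 =
     T1 + T2 + T3 - gcd T1 T2 - gcd T2 T3 - gcd T3 T1 + gcd T1 (gcd T2 T3)"

definition orth_compl :: "real \<Rightarrow> (real \<Rightarrow> complex) set \<Rightarrow> (real \<Rightarrow> complex) set" where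
  "orth_compl L F = {\<phi> \<in> L2 {0<..<L}.
     \<forall>f\<in>F. integral\<^sup>L (lebesgue_on {0<..<L}) (\<lambda>t. \<phi> t * cnj (f t)) = 0}"

text \<open>
  \<open>h\<close> is a real-valued function, not almost everywhere zero, whose complex multiples are, up to
  null sets, exactly the elements of the orthogonal complement of \<open>X_sum T1 T2 T3\<close>.
\<close>

definition is_h3 :: "nat \<Rightarrow> nat \<Rightarrow> nat \<Rightarrow> (real \<Rightarrow> real) \<Rightarrow> bool" where
  "is_h3 T1 T2 T3 h \<longleftrightarrow>
     (let L = real (crit_time T1 T2 T3); C = orth_compl L (X_sum T1 T2 T3) in
       (\<lambda>t. complex_of_real (h t)) \<in> C \<and>
       \<not> (AE t in lebesgue_on {0<..<L}. h t = 0) \<and>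
       (\<forall>\<phi>\<in>C. \<exists>c::complex. AE t in lebesgue_on {0<..<L}. \<phi> t = c * complex_of_real (h t)))"

end

theory Submission imports Defs begin

text \<open>
  Write \<open>[n]\<close> for \<open>x ^ n - 1\<close>, \<open>p\<close>, \<open>r\<close>, \<open>q\<close> for the gcds of \<open>(a, b)\<close>, \<open>(b, c)\<close>, \<open>(c, a)\<close>, and \<open>g\<close> for
  the gcd of the three periods \<open>a\<close>, \<open>b\<close>, \<open>c\<close>. A step function with value \<open>H\<^sub>j\<close> on \<open>(j, j + 1)\<close> is
  orthogonal to the \<open>a\<close>-periodic functions of mean zero as soon as \<open>[a] / [1]\<close> divides the
  polynomial \<open>\<Sum>\<^sub>j H\<^sub>j x ^ j\<close>. By inclusion-exclusion on roots of unity, the least common multiple of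
  \<open>[a] / [1]\<close>, \<open>[b] / [1]\<close>, \<open>[c] / [1]\<close> is \<open>([a] [b] [c] [g]) / ([p] [r] [q] [1])\<close>, of degree
  \<open>T - 1\<close>, so \<open>h\<close> is a multiple of the corresponding step function. Since \<open>p\<close> divides \<open>a\<close>, \<open>r\<close>
  divides \<open>b\<close> and \<open>q\<close> divides \<open>c\<close>, this is the product of the geometric sums \<open>[a] / [p]\<close>,
  \<open>[b] / [r]\<close>, \<open>[c] / [q]\<close>, \<open>[g] / [1]\<close>, and (i) follows. If \<open>g = 1\<close>, then the coefficient of \<open>x\<close>
  vanishes when \<open>p, q, r > 1\<close>, whereas all coefficients up to degree \<open>T - 1\<close> are positive when one
  of \<open>p, q, r\<close> is 1. The remaining inequalities in (ii) are automatic: \<open>p = a\<close> forces \<open>q\<close> to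
  divide \<open>p\<close>, hence \<open>q = 1\<close>.
\<close>

section \<open>Geometric sums and divisibility among the polynomials
  \<open>x ^ n - 1\<close>\<close>

definition geo :: "nat \<Rightarrow> nat \<Rightarrow> real poly" where
  "geo d n = (\<Sum>i<n. monom 1 (d * i))"

definition xpow_m1 :: "nat \<Rightarrow> real poly" where
  "xpow_m1 n = monom 1 n - 1"

lemma xpow_m1_nonzero: "n > 0 \<Longrightarrow> xpow_m1 n \<noteq> 0"
  by (auto simp: xpow_m1_def poly_eq_iff dest!: spec[of _ n])

lemma geo_Suc: "geo d (Suc n) = geo d n + monom 1 (d * n)"
  by (simp add: geo_def)

lemma geo_mult_xpow_m1: "geo d n * xpow_m1 d = xpow_m1 (d * n)"
proof (induction n)
  case (Suc n)
  then show ?case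
    by (simp add: geo_Suc distrib_right)
      (simp add: xpow_m1_def algebra_simps mult_monom flip: monom_0)
qed (simp add: geo_def xpow_m1_def)

lemma xpow_m1_dvd:
  assumes "d dvd n"
  shows "xpow_m1 d dvd xpow_m1 n"
  using assms geo_mult_xpow_m1 by (metis dvd_def dvd_triv_right)

lemma coeff_geo: "coeff (geo d n) k = (\<Sum>i<n. if d * i = k then 1 else 0)"
  by (simp add: geo_def coeff_sum)

lemma coeff_geo_Suc_0: "coeff (geo (Suc 0) n) k = (if k < n then 1 else 0)"
  by (auto simp: coeff_geo)

lemma degree_geo: "degree (geo d n) \<le> d * (n - 1)"
  unfolding geo_def by (intro degree_sum_le) (auto intro!: order.trans[OF degree_monom_le])

text \<open>Bezout's identity in the exponents: with \<open>d = gcd p r\<close> and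
  \<open>p * s = r * t + d\<close>, the difference \<open>[p * s] - x ^ d * [r * t]\<close>
  collapses to \<open>[d]\<close>.\<close>

lemma xpow_m1_gcd_bezout:
  assumes "p > 0"
  obtains u v where "xpow_m1 (gcd p r) = u * xpow_m1 p + v * xpow_m1 r"
proof -
  obtain s t where st: "p * s = r * t + gcd p r"
    using bezout_nat[of p r] assms by auto
  have "xpow_m1 (gcd p r) = xpow_m1 (p * s) - monom 1 (gcd p r) * xpow_m1 (r * t)"
    unfolding st by (simp add: xpow_m1_def algebra_simps mult_monom flip: monom_0)
  also have "\<dots> = geo p s * xpow_m1 p + (- monom 1 (gcd p r) * geo r t) * xpow_m1 r"
    by (simp add: mult.assoc flip: geo_mult_xpow_m1)
  finally show ?thesis by (rule that)
qed

text \<open>Expand \<open>[gcd p r]\<close> as \<open>u * [p] + v * [r]\<close> and multiply by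
  \<open>[b]\<close>: one term has the factor \<open>[p] * [b]\<close>, the other
  \<open>[b] * [r]\<close>, and \<open>[b]\<close> supplies the missing \<open>[r]\<close> or
  \<open>[p]\<close>.\<close>

lemma xpow_m1_mult_dvd:
  assumes "p > 0" "p dvd b" "r dvd b"
  shows "xpow_m1 p * xpow_m1 r dvd xpow_m1 b * xpow_m1 (gcd p r)"
proof -
  obtain u v where uv: "xpow_m1 (gcd p r) = u * xpow_m1 p + v * xpow_m1 r"
    using xpow_m1_gcd_bezout[OF assms(1)] .
  have "xpow_m1 p * xpow_m1 r dvd (xpow_m1 p * xpow_m1 b) * u"
    using assms by (intro dvd_mult2 mult_dvd_mono xpow_m1_dvd) auto
  moreover have "xpow_m1 p * xpow_m1 r dvd (xpow_m1 b * xpow_m1 r) * v"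
    using assms by (intro dvd_mult2 mult_dvd_mono xpow_m1_dvd) auto
  ultimately have "xpow_m1 p * xpow_m1 r dvd (xpow_m1 p * xpow_m1 b) * u + (xpow_m1 b * xpow_m1 r) * v"
    by (rule dvd_add)
  then show ?thesis by (simp add: uv algebra_simps)
qed

section \<open>The common multiple \<open>gap_poly\<close>\<close>

definition gap_poly :: "nat \<Rightarrow> nat \<Rightarrow> nat \<Rightarrow> real poly" where
  "gap_poly a b c =
     geo 1 (gcd a (gcd b c)) * geo (gcd a b) (a div gcd a b) *
     geo (gcd b c) (b div gcd b c) * geo (gcd c a) (c div gcd c a)"

lemma gap_poly_mult:
  "gap_poly a b c * (xpow_m1 (gcd a b) * xpow_m1 (gcd b c) * xpow_m1 (gcd c a) * xpow_m1 1) =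
   xpow_m1 a * xpow_m1 b * xpow_m1 c * xpow_m1 (gcd a (gcd b c))"
proof -
  have "xpow_m1 a = geo (gcd a b) (a div gcd a b) * xpow_m1 (gcd a b)"
    "xpow_m1 b = geo (gcd b c) (b div gcd b c) * xpow_m1 (gcd b c)"
    "xpow_m1 c = geo (gcd c a) (c div gcd c a) * xpow_m1 (gcd c a)"
    "xpow_m1 (gcd a (gcd b c)) = geo 1 (gcd a (gcd b c)) * xpow_m1 1"
    by (simp_all add: geo_mult_xpow_m1)
  then show ?thesis
    by (simp only: gap_poly_def mult_ac)
qed

text \<open>The pairing of periods with gcds is only one choice; the quotient in
  \<open>gap_poly_mult\<close> is symmetric. This lets facts proved for one period be used for all
  three.\<close>

lemma gap_poly_rotate:
  assumes "0 < a" "0 < b" "0 < c"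
  shows "gap_poly a b c = gap_poly b c a"
proof -
  let ?D = "xpow_m1 (gcd a b) * xpow_m1 (gcd b c) * xpow_m1 (gcd c a) * xpow_m1 1"
  have "gap_poly a b c * ?D = gap_poly b c a * ?D"
    using gap_poly_mult[of a b c] gap_poly_mult[of b c a] by (simp add: mult_ac gcd.commute gcd.left_commute)
  moreover have "?D \<noteq> 0" using assms by (simp add: xpow_m1_nonzero)
  ultimately show ?thesis by simp
qed

text \<open>Split off \<open>[a] / [1]\<close> and \<open>[c] / [q]\<close>. What remains is
  \<open>([b] * [g]) / ([p] * [r])\<close>, a polynomial because \<open>p\<close> and
  \<open>r\<close> divide \<open>b\<close> and have gcd \<open>g\<close>.\<close>

lemma geo_dvd_gap_poly:
  assumes "0 < a" "0 < b" "0 < c"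
  shows "geo 1 a dvd gap_poly a b c"
proof -
  let ?p = "gcd a b" and ?r = "gcd b c" and ?q = "gcd c a"
  have g: "gcd ?p ?r = gcd a (gcd b c)"
    by (simp add: gcd.assoc)
  obtain K where K: "xpow_m1 b * xpow_m1 (gcd a (gcd b c)) = xpow_m1 ?p * xpow_m1 ?r * K"
    using xpow_m1_mult_dvd[of ?p b ?r] assms unfolding g by (auto elim: dvdE)
  have "xpow_m1 a = geo 1 a * xpow_m1 1" "xpow_m1 c = geo ?q (c div ?q) * xpow_m1 ?q"
    by (simp_all add: geo_mult_xpow_m1)
  then have "xpow_m1 a * xpow_m1 b * xpow_m1 c * xpow_m1 (gcd a (gcd b c)) =
     (geo 1 a * xpow_m1 1) * (geo ?q (c div ?q) * xpow_m1 ?q) *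
       (xpow_m1 b * xpow_m1 (gcd a (gcd b c)))"
    by (simp only: mult_ac)
  also have "\<dots> = (geo 1 a * geo ?q (c div ?q) * K) *
       (xpow_m1 ?p * xpow_m1 ?r * xpow_m1 ?q * xpow_m1 1)"
    unfolding K by (simp only: mult_ac)
  finally have "gap_poly a b c = geo 1 a * geo ?q (c div ?q) * K"
    using assms unfolding gap_poly_mult[symmetric] by (simp add: xpow_m1_nonzero)
  then show ?thesis by simp
qed

section \<open>The critical time and the degree of \<open>gap_poly\<close>\<close>

lemma crit_time_eq:
  assumes "0 < a" "0 < b" "0 < c"
  shows "crit_time a b c =
    (a - gcd a b) + (b - gcd b c) + (c - gcd c a) + gcd a (gcd b c)"
proof -
  have "gcd a b \<le> a" "gcd b c \<le> b" "gcd c a \<le> c"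
    using assms by (simp_all add: gcd_le1_nat)
  then show ?thesis unfolding crit_time_def by linarith
qed

lemma crit_time_rotate:
  assumes "0 < a" "0 < b" "0 < c"
  shows "crit_time a b c = crit_time b c a"
proof -
  have "gcd b (gcd c a) = gcd a (gcd b c)"
    by (simp add: gcd.commute gcd.left_commute)
  then show ?thesis using assms by (simp only: crit_time_eq)
qed

lemma degree_gap_poly:
  assumes "0 < a" "0 < b" "0 < c"
  shows "degree (gap_poly a b c) < crit_time a b c"
proof -
  have *: "degree (geo d (n div d)) \<le> n - d" if "d dvd n" for d n
    using degree_geo[of d "n div d"] that by (simp add: diff_mult_distrib2)
  let ?g = "gcd a (gcd b c)"
  have "degree (gap_poly a b c) \<le> (?g - 1) + (a - gcd a b) + (b - gcd b c) + (c - gcd c a)"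
    unfolding gap_poly_def
    by (intro order.trans[OF degree_mult_le] add_mono *) (use degree_geo[of 1 ?g] in auto)
  moreover have "?g > 0" using assms by simp
  ultimately show ?thesis
    unfolding crit_time_eq[OF assms] by linarith
qed

section \<open>Signs and zeros of the coefficients\<close>

lemma coeff_mult_geo:
  "coeff (P * geo d n) k = (\<Sum>i<n. if d * i \<le> k then coeff P (k - d * i) else 0)"
  by (auto simp: geo_def sum_distrib_left coeff_sum mult.commute[of P] coeff_monom_mult
      intro!: sum.cong)

definition nonneg_coeffs :: "real poly \<Rightarrow> bool" where
  "nonneg_coeffs P \<longleftrightarrow> (\<forall>k. 0 \<le> coeff P k)"

lemma nonneg_coeffs_geo: "nonneg_coeffs (geo d n)"
  by (auto simp: nonneg_coeffs_def coeff_geo intro!: sum_nonneg)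

lemma nonneg_coeffs_mult: "nonneg_coeffs P \<Longrightarrow> nonneg_coeffs Q \<Longrightarrow> nonneg_coeffs (P * Q)"
  by (auto simp: nonneg_coeffs_def coeff_mult intro!: sum_nonneg)

lemma nonneg_coeffs_gap_poly: "nonneg_coeffs (gap_poly a b c)"
  unfolding gap_poly_def by (intro nonneg_coeffs_mult nonneg_coeffs_geo)

lemma coeff_0_geo: "d > 0 \<Longrightarrow> n > 0 \<Longrightarrow> coeff (geo d n) 0 = 1"
proof -
  assume "d > 0" "n > 0"
  then have "(\<Sum>i<n. if d * i = 0 then 1 else 0::real) = (\<Sum>i<n. if i = 0 then 1 else 0)"
    by (intro sum.cong) auto
  then show ?thesis using \<open>n > 0\<close> by (simp add: coeff_geo)
qed

lemma coeff_0_gap_poly: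
  assumes "0 < a" "0 < b" "0 < c"
  shows "coeff (gap_poly a b c) 0 = 1"
  using assms
  by (simp add: gap_poly_def coeff_mult_0 coeff_0_geo div_greater_zero_iff gcd_le1_nat)

text \<open>The product adds \<open>n\<close> copies of \<open>P\<close> shifted by multiples of
  \<open>d\<close>. As \<open>d \<le> N\<close>, the shifted blocks of \<open>N\<close> positive
  coefficients leave no gap, and nothing cancels.\<close>

lemma pos_coeffs_mult_geo:
  assumes P: "nonneg_coeffs P" "\<And>k. k < N \<Longrightarrow> 0 < coeff P k"
    and d: "0 < d" "d \<le> N" and k: "k < N + d * (n - 1)" "n > 0"
  shows "0 < coeff (P * geo d n) k"
proof -
  \<comment> \<open>The last copy starting at or before \<open>k\<close>. If it is not the final
    copy, \<open>k\<close> lies \<open>k mod d < d \<le> N\<close> beyond its start.\<close>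
  define i where "i = min (n - 1) (k div d)"
  have i: "i < n" "d * i \<le> k"
    using k unfolding i_def by (auto simp: min_def intro: order.trans[OF mult_le_mono2 times_div_less_eq_dividend])
  have "k - d * i < N"
  proof (cases "n - 1 \<le> k div d")
    case True
    then show ?thesis using k i d by (simp add: i_def min_absorb1)
  next
    case False
    then have "k - d * i = k mod d" by (simp add: i_def minus_mult_div_eq_mod)
    then show ?thesis using d mod_less_divisor[of d k] by linarith
  qed
  then show ?thesis
    unfolding coeff_mult_geo using P i
    by (intro sum_pos2[of _ i]) (auto simp: nonneg_coeffs_def)
qed

text \<open>Here \<open>g = p = 1\<close>, so \<open>[a] / [p]\<close> is a full block of
  \<open>a\<close> positive coefficients. The factor with step \<open>q \<le> a\<close> extends it
  to length \<open>a + (c - q)\<close>, which is at least \<open>c \<ge> r\<close>; the factor with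
  step \<open>r\<close> then extends it to length \<open>T\<close>.\<close>

lemma pos_coeffs_gap_poly:
  assumes pos: "0 < a" "0 < b" "0 < c" and p: "gcd a b = 1"
    and k: "k < crit_time a b c"
  shows "0 < coeff (gap_poly a b c) k"
proof -
  let ?r = "gcd b c" and ?q = "gcd c a"
  have g: "gcd a (gcd b c) = 1" using p by (simp flip: gcd.assoc)
  have le: "?q \<le> a" "?q \<le> c" "?r \<le> c" "?r \<le> b" "0 < ?q" "0 < ?r"
    using pos by (simp_all add: gcd_le1_nat gcd_le2_nat)
  have eq: "?q * (c div ?q - 1) = c - ?q" "?r * (b div ?r - 1) = b - ?r"
    by (simp_all add: diff_mult_distrib2)
  have gt: "0 < c div ?q" "0 < b div ?r"
    using le pos by (simp_all add: div_greater_zero_iff)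
  have "0 < coeff (geo 1 a * geo ?q (c div ?q) * geo ?r (b div ?r)) k"
  proof (rule pos_coeffs_mult_geo)
    show "0 < coeff (geo 1 a * geo ?q (c div ?q)) j" if "j < a + (c - ?q)" for j
      using that le eq gt by (intro pos_coeffs_mult_geo[of _ a]) (auto simp: nonneg_coeffs_geo coeff_geo_Suc_0)
    show "k < a + (c - ?q) + ?r * (b div ?r - 1)"
      using k pos(1) le unfolding eq crit_time_eq[OF pos] g p by linarith
  qed (use le gt in \<open>auto intro!: nonneg_coeffs_mult nonneg_coeffs_geo\<close>)
  moreover have "geo 1 1 = 1" by (simp add: geo_def)
  ultimately show ?thesis by (simp add: gap_poly_def g p mult_ac)
qed

lemma pos_coeffs_gap_poly':
  assumes pos: "0 < a" "0 < b" "0 < c"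
    and one: "gcd a b = 1 \<or> gcd b c = 1 \<or> gcd c a = 1" and k: "k < crit_time a b c"
  shows "0 < coeff (gap_poly a b c) k"
  using one
proof (elim disjE)
  assume "gcd a b = 1"
  then show ?thesis using pos k by (simp add: pos_coeffs_gap_poly)
next
  assume "gcd b c = 1"
  then have "0 < coeff (gap_poly b c a) k"
    using pos k crit_time_rotate[OF pos] by (intro pos_coeffs_gap_poly) auto
  then show ?thesis using gap_poly_rotate[OF pos] by simp
next
  assume "gcd c a = 1"
  then have "0 < coeff (gap_poly c a b) k"
    using pos k crit_time_rotate[of c a b] by (intro pos_coeffs_gap_poly) auto
  then show ?thesis using gap_poly_rotate[of c a b] pos by simp
qed

lemma coeff_1_geo: "d > 1 \<Longrightarrow> coeff (geo d n) 1 = 0"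
  by (auto simp: coeff_geo intro!: sum.neutral)

lemma coeff_1_mult: "coeff (P * Q) 1 = coeff P 0 * coeff Q 1 + coeff P 1 * coeff Q (0::nat)"
  by (simp add: coeff_mult)

text \<open>The factor \<open>[g] / [1]\<close> is 1, and the exponents in the other factors are
  multiples of numbers above 1, so no factor has a linear term.\<close>

lemma coeff_1_gap_poly:
  assumes "1 < gcd a b" "1 < gcd b c" "1 < gcd c a" "gcd a (gcd b c) = 1"
  shows "coeff (gap_poly a b c) 1 = 0"
  using assms coeff_geo_Suc_0[of 1 1] by (simp only: gap_poly_def coeff_1_mult coeff_1_geo) simp

section \<open>Arithmetic of the condition in (ii)\<close>

lemma gcd_cond_iff:
  fixes a b c :: nat
  assumes pos: "0 < a" "0 < b" "0 < c" and g: "gcd a (gcd b c) = 1"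
  shows "(1 < gcd a b \<and> gcd a b < min a b \<and> 1 < gcd b c \<and> gcd b c < min b c \<and>
      1 < gcd c a \<and> gcd c a < min c a) \<longleftrightarrow>
    \<not> (gcd a b = 1 \<or> gcd b c = 1 \<or> gcd c a = 1)"
proof -
  have lt: "gcd x y < min x y"
    if "0 < x" "0 < y" "gcd x z \<noteq> 1" "gcd y z \<noteq> 1" "gcd x (gcd y z) = 1" for x y z :: nat
  proof -
    \<comment> \<open>If \<open>gcd x y = x\<close>, the triple gcd equals \<open>gcd x z\<close>,
      which would then be 1.\<close>
    have "gcd x y \<noteq> x" using that by (metis gcd.assoc)
    moreover have "gcd x y \<noteq> y" using that by (metis gcd.assoc gcd.commute)
    ultimately show ?thesis
      using that by (metis gcd_le1_nat gcd_le2_nat le_neq_implies_less less_not_refl min_less_iff_conj)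
  qed
  have gt: "1 < gcd x y \<longleftrightarrow> gcd x y \<noteq> 1" if "0 < x" for x y :: nat
    using that gcd_pos_nat[of x y] by linarith
  show ?thesis
    using lt[of a b c] lt[of b c a] lt[of c a b] gt[of a b] gt[of b c] gt[of c a] pos g
    by (auto simp: gcd.commute gcd.left_commute)
qed

section \<open>Integrals of periodic functions over unit intervals\<close>

lemma L2_imp_set_integrable:
  assumes f: "f \<in> L2 A" and A: "A \<in> lmeasurable"
  shows "set_integrable lebesgue A f"
proof -
  interpret finite_measure "lebesgue_on A"
    using A by (rule finite_measure_lebesgue_on)
  have "integrable (lebesgue_on A) f"
  proof (rule Bochner_Integration.integrable_bound)
    show "integrable (lebesgue_on A) (\<lambda>t. 1 + (cmod (f t))\<^sup>2)"
      using f by (simp add: L2_def)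
    have "x \<le> 1 + x\<^sup>2" for x :: real
    proof -
      have "2 * x \<le> 1 + x\<^sup>2"
        using zero_le_power2[of "x - 1"] by (simp add: power2_diff)
      then show ?thesis using zero_le_power2[of x] by linarith
    qed
    then show "AE t in lebesgue_on A. norm (f t) \<le> norm (1 + (cmod (f t))\<^sup>2)"
      by (intro AE_I2) (simp add: abs_of_nonneg)
  qed (use f in \<open>simp add: L2_def\<close>)
  then show ?thesis
    using A by (simp add: integrable_restrict_space set_integrable_def fmeasurableD)
qed

lemma X_space_set_integrable:
  assumes "f \<in> X_space S"
  shows "set_integrable lebesgue {u..v} f"
  using assms by (intro L2_imp_set_integrable) (auto simp: X_space_def)

lemma X_space_integrable_on:
  assumes "f \<in> X_space S"
  shows "f integrable_on {u..v}"
  using X_space_set_integrable[OF assms] by (rule set_lebesgue_integral_eq_integral)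

lemma X_space_integral_period:
  assumes f: "f \<in> X_space S"
  shows "integral {0..S} f = 0"
proof -
  have "integrable (lebesgue_on {0..S}) f"
    using X_space_set_integrable[OF f, of 0 S]
    by (simp add: integrable_restrict_space set_integrable_def)
  then have "integral\<^sup>L (lebesgue_on {0..S}) f = integral {0..S} f"
    by (rule lebesgue_integral_eq_integral) simp
  then show ?thesis using f by (simp add: X_space_def)
qed

text \<open>These numbers are all that a step function with jumps at integers sees of
  \<open>f\<close>.\<close>

definition unit_integral :: "(real \<Rightarrow> complex) \<Rightarrow> nat \<Rightarrow> complex" where
  "unit_integral f j = integral {real j..real j + 1} f"

lemma unit_integral_shift:
  assumes f: "f \<in> X_space (real a)"
  shows "unit_integral f (j + a) = unit_integral f j"
proof -
  have "(f has_integral unit_integral f (j + a)) {real j + real a..real j + 1 + real a}"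
    using integrable_integral[OF X_space_integrable_on[OF f, of "real (j + a)" "real (j + a) + 1"]]
    by (simp add: unit_integral_def add_ac)
  then have "((\<lambda>t. f (t + real a)) has_integral unit_integral f (j + a)) {real j..real j + 1}"
    by (auto dest: has_integral_shift_real_ivl[of _ _ _ _ "real a"])
  moreover have "(\<lambda>t. f (t + real a)) = f"
    using f by (auto simp: X_space_def)
  ultimately show ?thesis
    by (simp add: unit_integral_def integral_unique)
qed

lemma sum_unit_integral:
  assumes f: "\<And>u v. f integrable_on {u..v}"
  shows "(\<Sum>j<n. unit_integral f j) = integral {0..real n} f"
proof (induction n)
  case (Suc n)
  have "integral {0..real n} f + integral {real n..real n + 1} f = integral {0..real n + 1} f"
    by (rule Henstock_Kurzweil_Integration.integral_combine) (auto intro: f)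
  with Suc show ?case by (simp add: unit_integral_def add_ac)
qed simp

text \<open>Moving the window by one exchanges the integral at \<open>m\<close> for that at
  \<open>m + a\<close>, equal by periodicity; the initial window is the mean over a period.\<close>

lemma sum_unit_integral_window:
  assumes f: "f \<in> X_space (real a)"
  shows "(\<Sum>j\<in>{m..<m + a}. unit_integral f j) = 0"
proof (induction m)
  case 0
  show ?case
    using sum_unit_integral[OF X_space_integrable_on[OF f], of a] X_space_integral_period[OF f]
    by (simp add: lessThan_atLeast0)
next
  case (Suc m)
  show ?case
  proof (cases "a = 0")
    case False
    have "(\<Sum>j\<in>{Suc m..<Suc m + a}. unit_integral f j) =
      (\<Sum>j\<in>{Suc m..<m + a}. unit_integral f j) + unit_integral f (m + a)"
      using False by simp
    also have "\<dots> = (\<Sum>j\<in>{m..<m + a}. unit_integral f j)"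
      using False unfolding unit_integral_shift[OF f]
      by (simp add: sum.atLeast_Suc_lessThan add.commute)
    finally show ?thesis using Suc by simp
  qed simp
qed

text \<open>For \<open>P = Q * geo 1 a\<close>, the coefficients of \<open>P\<close> are a
  combination of indicators of windows of \<open>a\<close> consecutive indices, and each window sums
  to 0.\<close>

lemma sum_coeff_unit_integral:
  assumes f: "f \<in> X_space (real a)" and a: "0 < a" and dvd: "geo 1 a dvd P" and deg: "degree P < T"
  shows "(\<Sum>j<T. of_real (coeff P j) * unit_integral f j) = 0"
proof (cases "P = 0")
  case False
  obtain Q where Q: "P = Q * geo 1 a" using dvd by (metis dvdE mult.commute)
  have "a - 1 \<le> degree (geo 1 a)"
    by (rule le_degree) (use a in \<open>simp add: coeff_geo_Suc_0\<close>)
  \<comment> \<open>By \<open>degree Q + (a - 1) < T\<close>, no window is cut off at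
    \<open>T\<close>.\<close>
  then have le: "k + a \<le> T" if "k \<le> degree Q" for k
    using that False deg unfolding Q by (subst (asm) degree_mult_eq) auto
  have "coeff P j = (\<Sum>k\<le>degree Q. coeff Q k * (if j \<in> {k..<k + a} then 1 else 0))" for j
  proof -
    have "P = (\<Sum>k\<le>degree Q. monom (coeff Q k) k * geo 1 a)"
      unfolding Q sum_distrib_right[symmetric] by (simp only: poly_as_sum_of_monoms)
    then show ?thesis
      by (auto simp: coeff_sum coeff_monom_mult coeff_geo_Suc_0 intro!: sum.cong)
  qed
  then have "(\<Sum>j<T. of_real (coeff P j) * unit_integral f j) =
    (\<Sum>j<T. \<Sum>k\<le>degree Q. of_real (coeff Q k) * (if j \<in> {k..<k + a} then unit_integral f j else 0))"
    by (auto simp: sum_distrib_right intro!: sum.cong)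
  also have "\<dots> = (\<Sum>k\<le>degree Q. of_real (coeff Q k) *
      (\<Sum>j<T. if j \<in> {k..<k + a} then unit_integral f j else 0))"
    by (subst sum.swap) (simp add: sum_distrib_left)
  also have "\<dots> = (\<Sum>k\<le>degree Q. of_real (coeff Q k) * (\<Sum>j\<in>{k..<k + a}. unit_integral f j))"
  proof -
    have "(\<Sum>j<T. if j \<in> {k..<k + a} then unit_integral f j else 0) =
        (\<Sum>j\<in>{k..<k + a}. unit_integral f j)" if "k \<le> degree Q" for k
    proof -
      have "{..<T} \<inter> {k..<k + a} = {k..<k + a}" using le[OF that] by auto
      then show ?thesis
        using sum.inter_restrict[of "{..<T}" "unit_integral f" "{k..<k + a}"] by simp
    qed
    then show ?thesis by simp
  qed
  also have "\<dots> = 0" using sum_unit_integral_window[OF f] by simp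
  finally show ?thesis .
qed simp

section \<open>Step functions and orthogonality\<close>

definition step_fun :: "(nat \<Rightarrow> real) \<Rightarrow> nat \<Rightarrow> real \<Rightarrow> real" where
  "step_fun c n t = (\<Sum>j<n. c j * indicator {real j<..<real j + 1} t)"

lemma step_fun_eq:
  assumes "real j < t" "t < real j + 1" "j < n"
  shows "step_fun c n t = c j"
proof -
  have "c i * indicator {real i<..<real i + 1} t = (if i = j then c j else 0)" for i
    using assms by (auto simp: indicator_def)
  then show ?thesis using assms by (simp add: step_fun_def)
qed

lemma step_fun_nonneg: "(\<And>j. 0 \<le> c j) \<Longrightarrow> 0 \<le> step_fun c n t"
  unfolding step_fun_def by (intro sum_nonneg) simp

lemma step_fun_in_L2: "(\<lambda>t. complex_of_real (step_fun c n t)) \<in> L2 {0<..<L}"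
proof -
  interpret finite_measure "lebesgue_on {0<..<L::real}"
    by (rule finite_measure_lebesgue_on) simp
  have [measurable]: "step_fun c n \<in> borel_measurable borel"
    unfolding step_fun_def[abs_def] by measurable
  then have m: "step_fun c n \<in> borel_measurable (lebesgue_on {0<..<L})"
    by (intro measurable_restrict_space1 measurable_completion) simp
  have "\<bar>step_fun c n t\<bar> \<le> (\<Sum>j<n. \<bar>c j\<bar>)" for t
    unfolding step_fun_def
    by (intro order.trans[OF sum_abs] sum_mono) (auto simp: indicator_def)
  then have "(step_fun c n t)\<^sup>2 \<le> (\<Sum>j<n. \<bar>c j\<bar>)\<^sup>2" for t
    by (metis abs_ge_zero power2_abs power_mono)
  then have "integrable (lebesgue_on {0<..<L}) (\<lambda>t. (step_fun c n t)\<^sup>2)"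
    using m by (intro integrable_const_bound[of _ "(\<Sum>j<n. \<bar>c j\<bar>)\<^sup>2"]) auto
  then show ?thesis using m by (simp add: L2_def)
qed

lemma integral_step_fun:
  fixes c :: "nat \<Rightarrow> real" and n :: nat
  assumes f: "\<And>u v. set_integrable lebesgue {u..v} f"
  defines "F \<equiv> \<lambda>t. complex_of_real (step_fun c n t) * cnj (f t)"
  shows "integrable (lebesgue_on {0<..<real n}) F"
    and "integral\<^sup>L (lebesgue_on {0<..<real n}) F = (\<Sum>j<n. of_real (c j) * cnj (unit_integral f j))"
proof -
  let ?I = "\<lambda>j. {real j<..<real j + 1}"
  have I: "set_integrable lebesgue (?I j) f" for j
    using f[of "real j" "real j + 1"] by (rule set_integrable_subset) auto
  \<comment> \<open>Each unit interval lies in \<open>(0, n)\<close>, so the outer indicator is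
    absorbed. Keeping \<open>f\<close> and its indicator under one \<open>cnj\<close> lets
    conjugation commute with the integral.\<close>
  have eq: "indicator {0<..<real n} t *\<^sub>R F t =
    (\<Sum>j<n. of_real (c j) * cnj (indicator (?I j) t *\<^sub>R f t))" for t
  proof -
    have *: "complex_of_real (indicator {0<..<real n} t) * complex_of_real (indicator (?I j) t) =
        complex_of_real (indicator (?I j) t)" if "j < n" for j
      using that by (auto simp: indicator_def)
    have "indicator {0<..<real n} t *\<^sub>R F t = (\<Sum>j<n. of_real (c j) * cnj (f t) *
        (complex_of_real (indicator {0<..<real n} t) * complex_of_real (indicator (?I j) t)))"
      unfolding F_def step_fun_def scaleR_conv_of_real of_real_sum of_real_mult
        sum_distrib_left sum_distrib_right
      by (simp only: mult_ac)
    also have "\<dots> = (\<Sum>j<n. of_real (c j) * cnj (f t) * complex_of_real (indicator (?I j) t))"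
      using * by (intro sum.cong refl) (simp only: lessThan_iff)
    finally show ?thesis
      by (simp only: scaleR_conv_of_real complex_cnj_mult complex_cnj_complex_of_real mult_ac)
  qed
  have int: "integrable lebesgue (\<lambda>t. of_real (c j) * cnj (indicator (?I j) t *\<^sub>R f t))" for j
    using I[of j] unfolding set_integrable_def
    by (intro integrable_mult_right) (simp only: integrable_cnj)
  then show "integrable (lebesgue_on {0<..<real n}) F"
    by (simp add: integrable_restrict_space eq del: complex_cnj_scaleR complex_cnj_mult)
  have "integral\<^sup>L lebesgue (\<lambda>t. indicator (?I j) t *\<^sub>R f t) = unit_integral f j" for j
  proof -
    have "integral\<^sup>L lebesgue (\<lambda>t. indicator (?I j) t *\<^sub>R f t) = integral (?I j) f"
      using set_lebesgue_integral_eq_integral(2)[OF I[of j]] by (simp add: set_lebesgue_integral_def)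
    also have "\<dots> = integral {real j..real j + 1} f"
      using integral_open_interval[of "real j" "real j + 1" f] by simp
    finally show ?thesis by (simp add: unit_integral_def)
  qed
  then show "integral\<^sup>L (lebesgue_on {0<..<real n}) F = (\<Sum>j<n. of_real (c j) * cnj (unit_integral f j))"
    using int
    by (simp add: integral_restrict_space eq del: complex_cnj_scaleR complex_cnj_mult)
qed

text \<open>Rotation gives divisibility by all three geometric sums, so the three summands of an
  element of \<open>X_sum\<close> can be treated separately.\<close>

lemma step_fun_gap_poly_orthogonal:
  assumes pos: "0 < a" "0 < b" "0 < c" and T: "T = crit_time a b c" and P: "P = gap_poly a b c"
  shows "(\<lambda>t. complex_of_real (step_fun (coeff P) T t)) \<in> orth_compl (real T) (X_sum a b c)"
proof -
  let ?\<phi> = "\<lambda>t. complex_of_real (step_fun (coeff P) T t)"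
  let ?M = "lebesgue_on {0<..<real T}"
  have dvd: "geo 1 a dvd P" "geo 1 b dvd P" "geo 1 c dvd P"
    using geo_dvd_gap_poly[of a b c] geo_dvd_gap_poly[of b c a] geo_dvd_gap_poly[of c a b]
      gap_poly_rotate[of a b c] gap_poly_rotate[of c a b] pos P by simp_all
  have deg: "degree P < T" using degree_gap_poly[OF pos] P T by simp
  have *: "integrable ?M (\<lambda>t. ?\<phi> t * cnj (f t)) \<and> integral\<^sup>L ?M (\<lambda>t. ?\<phi> t * cnj (f t)) = 0"
    if f: "f \<in> X_space (real d)" and d: "0 < d" "geo 1 d dvd P" for f d
  proof -
    have "integral\<^sup>L ?M (\<lambda>t. ?\<phi> t * cnj (f t)) = (\<Sum>j<T. of_real (coeff P j) * cnj (unit_integral f j))"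
      using f by (intro integral_step_fun X_space_set_integrable)
    also have "\<dots> = cnj (\<Sum>j<T. of_real (coeff P j) * unit_integral f j)" by simp
    also have "\<dots> = 0" using sum_coeff_unit_integral[OF f d deg] by simp
    finally show ?thesis using integral_step_fun(1) X_space_set_integrable[OF f] by blast
  qed
  have "integral\<^sup>L ?M (\<lambda>t. ?\<phi> t * cnj (f t)) = 0" if "f \<in> X_sum a b c" for f
  proof -
    obtain f1 f2 f3 where f: "f = (\<lambda>t. f1 t + f2 t + f3 t)"
      and "f1 \<in> X_space (real a)" "f2 \<in> X_space (real b)" "f3 \<in> X_space (real c)"
      using \<open>f \<in> X_sum a b c\<close> unfolding X_sum_def by blast
    then show ?thesis
      using *[of f1 a] *[of f2 b] *[of f3 c] dvd pos by (simp add: f distrib_left)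
  qed
  then show ?thesis unfolding orth_compl_def using step_fun_in_L2 by blast
qed

section \<open>Transfer from the step function to \<open>h\<close>\<close>

lemma AE_lebesgue_on_open_interval_D:
  fixes a b :: real
  assumes "AE t in lebesgue_on {a<..<b}. P t" "a < b"
  shows "\<exists>t\<in>{a<..<b}. P t"
proof (rule ccontr)
  assume "\<not> ?thesis"
  with assms(1) have "AE t in lebesgue. t \<notin> {a<..<b}"
    by (auto simp: AE_restrict_space_iff elim!: AE_mp)
  then have "{a<..<b} \<in> null_sets lebesgue"
    by (subst (asm) AE_iff_null_sets[symmetric]) auto
  then show False using assms(2) by (simp add: null_sets_def)
qed

lemma AE_lebesgue_on_subset:
  fixes A B :: "real set"
  assumes "AE t in lebesgue_on B. P t" "A \<subseteq> B" "A \<in> sets lebesgue" "B \<in> sets lebesgue"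
  shows "AE t in lebesgue_on A. P t"
  using assms by (auto simp: AE_restrict_space_iff elim!: AE_mp)

theorem theorem1p1:
  fixes T1 T2 T3 :: nat and h :: "real \<Rightarrow> real"
  assumes "0 < T1" and "0 < T2" and "0 < T3"
    and "is_h3 T1 T2 T3 h"
    and "\<exists>\<delta>>0. AE t in lebesgue_on {0<..<\<delta>}. 0 < h t"
  shows "(AE t in lebesgue_on {0<..<real (crit_time T1 T2 T3)}. 0 \<le> h t) \<and>
    (gcd T1 (gcd T2 T3) = 1 \<longrightarrow>
      ((\<exists>j\<in>{1..crit_time T1 T2 T3}. AE t in lebesgue_on {real j - 1<..<real j}. h t = 0) \<longleftrightarrow>
       (1 < gcd T1 T2 \<and> gcd T1 T2 < min T1 T2 \<and>
        1 < gcd T2 T3 \<and> gcd T2 T3 < min T2 T3 \<and>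
        1 < gcd T3 T1 \<and> gcd T3 T1 < min T3 T1)))"
proof -
  define T where "T = crit_time T1 T2 T3"
  define P where "P = gap_poly T1 T2 T3"
  note pos = assms(1-3)
  have "degree P < T" using degree_gap_poly[OF pos] by (simp add: P_def T_def)
  then have T: "0 < T" by simp
  have nonneg: "0 \<le> coeff P j" for j
    using nonneg_coeffs_gap_poly by (simp add: P_def nonneg_coeffs_def)
  have "\<forall>\<phi>\<in>orth_compl (real T) (X_sum T1 T2 T3).
      \<exists>k. AE t in lebesgue_on {0<..<real T}. \<phi> t = k * complex_of_real (h t)"
    using assms(4) unfolding is_h3_def Let_def T_def by simp
  from bspec[OF this step_fun_gap_poly_orthogonal[OF pos T_def P_def]]
  obtain k :: complex
    where k: "AE t in lebesgue_on {0<..<real T}.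
      complex_of_real (step_fun (coeff P) T t) = k * complex_of_real (h t)" ..
  \<comment> \<open>Both functions are real, so the real part of \<open>k\<close> serves as the
    factor.\<close>
  define c where "c = Re k"
  have c: "AE t in lebesgue_on {0<..<real T}. step_fun (coeff P) T t = c * h t"
    using k by eventually_elim (simp add: c_def complex_eq_iff)
  have "0 < c"
  proof -
    obtain \<delta> where \<delta>: "\<delta> > 0" "AE t in lebesgue_on {0<..<\<delta>}. 0 < h t"
      using assms(5) by blast
    \<comment> \<open>On \<open>(0, e)\<close> the step function takes its first value
      \<open>coeff P 0 = 1\<close> and \<open>h\<close> is positive almost everywhere; one common
      point fixes the sign of \<open>c\<close>.\<close>
    define e where "e = min 1 \<delta>"
    have "AE t in lebesgue_on {0<..<e}. 0 < h t"
      using \<delta>(2) by (rule AE_lebesgue_on_subset) (auto simp: e_def)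
    moreover have "AE t in lebesgue_on {0<..<e}. step_fun (coeff P) T t = c * h t"
      using c by (rule AE_lebesgue_on_subset) (use T in \<open>auto simp: e_def\<close>)
    ultimately have "AE t in lebesgue_on {0<..<e}. 0 < h t \<and> step_fun (coeff P) T t = c * h t"
      by eventually_elim simp
    from AE_lebesgue_on_open_interval_D[OF this] \<delta>(1)
    obtain t where t: "0 < t" "t < e" "0 < h t" "step_fun (coeff P) T t = c * h t"
      by (auto simp: e_def)
    then have "c * h t = 1"
      using step_fun_eq[of 0 t T "coeff P"] T coeff_0_gap_poly[OF pos] by (simp add: e_def P_def)
    then show "0 < c" using t(3) by (metis zero_less_mult_pos2 zero_less_one)
  qed
  have "AE t in lebesgue_on {0<..<real T}. 0 \<le> h t"
    using c
  proof eventually_elim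
    case (elim t)
    then have "0 \<le> c * h t" using step_fun_nonneg[of "coeff P" T t] nonneg by simp
    then show ?case using \<open>0 < c\<close> by (simp add: zero_le_mult_iff)
  qed
  \<comment> \<open>On \<open>(j - 1, j)\<close> the product \<open>c * h\<close> is almost
    everywhere \<open>coeff P (j - 1)\<close>, and \<open>c\<close> is nonzero.\<close>
  moreover have "(\<exists>j\<in>{1..T}. AE t in lebesgue_on {real j - 1<..<real j}. h t = 0) \<longleftrightarrow>
      (\<exists>j\<in>{1..T}. coeff P (j - 1) = 0)"
  proof (rule bex_cong[OF refl])
    fix j assume j: "j \<in> {1..T}"
    show "(AE t in lebesgue_on {real j - 1<..<real j}. h t = 0) \<longleftrightarrow> coeff P (j - 1) = 0"
    proof -
      have "AE t in lebesgue_on {real j - 1<..<real j}. step_fun (coeff P) T t = c * h t"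
        using c by (rule AE_lebesgue_on_subset) (use j in auto)
      then have *: "AE t in lebesgue_on {real j - 1<..<real j}. coeff P (j - 1) = c * h t"
      proof (rule lebesgue_on_mono)
        show "coeff P (j - 1) = c * h t"
          if "step_fun (coeff P) T t = c * h t" "t \<in> {real j - 1<..<real j}" for t
          using that j step_fun_eq[of "j - 1" t T "coeff P"] by (auto simp: of_nat_diff)
      qed
      show ?thesis
      proof
        assume "AE t in lebesgue_on {real j - 1<..<real j}. h t = 0"
        with * have "AE t in lebesgue_on {real j - 1<..<real j}. coeff P (j - 1) = 0"
          by eventually_elim simp
        then show "coeff P (j - 1) = 0"
          using AE_lebesgue_on_open_interval_D[where a="real j - 1" and b="real j"] by auto
      next
        assume zero: "coeff P (j - 1) = 0"
        from * show "AE t in lebesgue_on {real j - 1<..<real j}. h t = 0"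
          by eventually_elim (use zero \<open>0 < c\<close> in simp)
      qed
    qed
  qed
  moreover have "(\<exists>j\<in>{1..T}. coeff P (j - 1) = 0) \<longleftrightarrow>
      \<not> (gcd T1 T2 = 1 \<or> gcd T2 T3 = 1 \<or> gcd T3 T1 = 1)" (is "_ \<longleftrightarrow> \<not> ?one")
    if g: "gcd T1 (gcd T2 T3) = 1"
  proof
    assume "\<exists>j\<in>{1..T}. coeff P (j - 1) = 0"
    then obtain j where "j < T" "coeff P j = 0"
      by (metis One_nat_def Suc_pred atLeastAtMost_iff less_eq_Suc_le)
    then show "\<not> ?one" using pos_coeffs_gap_poly'[OF pos, of j] by (auto simp: P_def T_def)
  next
    assume "\<not> ?one"
    then have cond: "1 < gcd T1 T2" "gcd T1 T2 < T1" "1 < gcd T2 T3" "1 < gcd T3 T1"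
      using gcd_cond_iff[OF pos g] by auto
    \<comment> \<open>The zero coefficient of \<open>x\<close> belongs to the interval
      \<open>(1, 2)\<close>, that is \<open>j = 2\<close>, which must lie within
      \<open>(0, T)\<close>.\<close>
    then have "2 \<le> T" unfolding T_def crit_time_eq[OF pos] g by linarith
    then show "\<exists>j\<in>{1..T}. coeff P (j - 1) = 0"
      using coeff_1_gap_poly[OF cond(1,3,4) g] by (intro bexI[of _ 2]) (auto simp: P_def)
  qed
  ultimately show ?thesis
    using gcd_cond_iff[OF pos] unfolding T_def[symmetric] by simp
qed

end
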